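(* Let $K=\mathbb{F}_q$, $n\ge 1$, let $A_0,\dots,A_n\subset K$ with $d_i=|A_i|$ and $2\le d_0\le d_1\le\cdots\le d_n$, and suppose that $\mathcal{X}=[A_0\times\cdots\times A_n]\subset\mathbb{P}^n(K)$ is a projective nested cartesian set. Then the minimum distance $\delta_{\mathcal X}(d)$ of $C_{\mathcal X}(d)$ satisfies: (1) if $1\le d\le\sum_{i=1}^n(d_i-1)$, then $$\delta_{\mathcal X}(d)\le(d_{k+1}-\ell)\,d_{k+2}\cdots d_n,$$ where $0\le k\le n-1$ and $0\le\ell<d_{k+1}-1$ are the unique integers such that $d-1=\sum_{i=1}^k(d_i-1)+\ell$; (2) if $d>\sum_{i=1}^n(d_i-1)$, then $\delta_{\mathcal X}(d)=1$.
   Context: For non-empty $A_0,\dots,A_n\subset K$, $[A_0\times\cdots\times A_n]$ denotes the set of points $(a_0:\cdots:a_n)\in\mathbb{P}^n(K)$ with $a_i\in A_i$ for all $i$ (not all zero). For $A,B\subset K$, $\frac{A}{B}:=\{a/b : a\in A,\ b\in B\setminus\{0\}\}$. The set $\mathcal X=[A_0\times\cdots\times A_n]$ is a projective nested cartesian set if (i) $0\in A_i$ for all $i=0,\dots,n$, and (ii) for every $i=1,\dots,n$ and every $j=i,\dots,n$ one has $\frac{A_j}{A_{i-1}}\subset A_j$. Let $S=K[X_0,\dots,X_n]$ and let $S_d$ be the $K$-vector space of homogeneous polynomials of degree $d$ together with $0$. Let $P_1,\dots,P_m$ be the points of $\mathcal X$, each written with its standard representative (first nonzero entry, from the left, equal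 to $1$). The code $C_{\mathcal X}(d)$ is the image of the evaluation map $\varphi_d:S_d\to K^{|\mathcal X|}$, $f\mapsto(f(P_1),\dots,f(P_m))$, and its minimum distance is $\delta_{\mathcal X}(d)=\min\{|\varphi_d(f)| : f\in S_d,\ \varphi_d(f)\ne 0\}$, where $|\varphi_d(f)|$ is the number of nonzero entries. If $k=n-1$, the empty product $d_{k+2}\cdots d_n$ equals $1$. *)

theory Defs
  imports Complex_Main "HOL-Library.Poly_Mapping" "HOL-Library.FuncSet"
begin

section \<open>Homogeneous polynomials in $X_0, \dots, X_n$\<close>

text \<open>A monomial is a finitely supported exponent vector, a polynomial a finitely supported
  family of coefficients indexed by monomials.\<close>

type_synonym 'a mpol = "(nat \<Rightarrow>\<^sub>0 nat) \<Rightarrow>\<^sub>0 'a"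

definition eval_mpol :: "'a::comm_semiring_1 mpol \<Rightarrow> (nat \<Rightarrow> 'a) \<Rightarrow> 'a" where
  "eval_mpol f v =
    (\<Sum>m\<in>Poly_Mapping.keys f. Poly_Mapping.lookup f m *
       (\<Prod>i\<in>Poly_Mapping.keys m. v i ^ Poly_Mapping.lookup m i))"

text \<open>The zero polynomial has no monomials, hence belongs to every \<open>hom_polys n d\<close>.\<close>

definition hom_polys :: "nat \<Rightarrow> nat \<Rightarrow> 'a::comm_semiring_1 mpol set" where
  "hom_polys n d = {f. \<forall>m\<in>Poly_Mapping.keys f.
     Poly_Mapping.keys m \<subseteq> {..n} \<and> (\<Sum>i\<le>n. Poly_Mapping.lookup m i) = d}"

section \<open>Projective space\<close>

text \<open>A vector $(v_0, \dots, v_n)$ is encoded as a function on \<open>nat\<close> vanishing beyond \<open>n\<close>,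
  so that equality of functions is equality of vectors.\<close>

definition nonzero_vecs :: "nat \<Rightarrow> (nat \<Rightarrow> 'a::field) set" where
  "nonzero_vecs n = {v. (\<forall>i>n. v i = 0) \<and> (\<exists>i\<le>n. v i \<noteq> 0)}"

definition proj_rel :: "nat \<Rightarrow> ((nat \<Rightarrow> 'a::field) \<times> (nat \<Rightarrow> 'a)) set" where
  "proj_rel n = {(v, w). v \<in> nonzero_vecs n \<and> w \<in> nonzero_vecs n \<and>
     (\<exists>c. c \<noteq> 0 \<and> (\<forall>i. w i = c * v i))}"

definition proj_space :: "nat \<Rightarrow> (nat \<Rightarrow> 'a::field) set set" where
  "proj_space n = nonzero_vecs n // proj_rel n"

text \<open>The representative whose first nonzero entry, from the left, equals 1.\<close>

definition std_rep :: "(nat \<Rightarrow> 'a::field) set \<Rightarrow> (nat \<Rightarrow> 'a)" where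
  "std_rep P = (THE v. v \<in> P \<and> (\<exists>i. v i = 1 \<and> (\<forall>j<i. v j = 0)))"

lemma equiv_proj_rel: "equiv (nonzero_vecs n) (proj_rel n :: ((nat \<Rightarrow> 'a::field) \<times> _) set)"
proof (rule equivI)
  show "proj_rel n \<subseteq> nonzero_vecs n \<times> (nonzero_vecs n :: (nat \<Rightarrow> 'a) set)"
    by (auto simp: proj_rel_def)
  show "refl_on (nonzero_vecs n) (proj_rel n :: ((nat \<Rightarrow> 'a) \<times> _) set)"
    by (auto simp: proj_rel_def refl_on_def intro: exI[of _ 1])
  show "sym (proj_rel n :: ((nat \<Rightarrow> 'a) \<times> _) set)"
  proof (rule symI)
    fix v w :: "nat \<Rightarrow> 'a"
    assume "(v, w) \<in> proj_rel n"
    then obtain c where "v \<in> nonzero_vecs n" "w \<in> nonzero_vecs n" "c \<noteq> 0" "\<forall>i. w i = c * v i"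
      by (auto simp: proj_rel_def)
    then show "(w, v) \<in> proj_rel n"
      by (auto simp: proj_rel_def intro!: exI[of _ "inverse c"])
  qed
  show "trans (proj_rel n :: ((nat \<Rightarrow> 'a) \<times> _) set)"
  proof (rule transI)
    fix u v w :: "nat \<Rightarrow> 'a"
    assume "(u, v) \<in> proj_rel n" "(v, w) \<in> proj_rel n"
    then obtain c e where "u \<in> nonzero_vecs n" "w \<in> nonzero_vecs n"
      "c \<noteq> 0" "\<forall>i. v i = c * u i" "e \<noteq> 0" "\<forall>i. w i = e * v i"
      by (auto simp: proj_rel_def)
    then show "(u, w) \<in> proj_rel n"
      by (auto simp: proj_rel_def mult.assoc intro!: exI[of _ "e * c"])
  qed
qed

lemma std_rep_unique:
  fixes P :: "(nat \<Rightarrow> 'a::field) set"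
  assumes "P \<in> proj_space n"
  shows "\<exists>!v. v \<in> P \<and> (\<exists>i. v i = 1 \<and> (\<forall>j<i. v j = 0))"
proof -
  obtain u where u: "u \<in> nonzero_vecs n" and P: "P = proj_rel n `` {u}"
    using assms unfolding proj_space_def by (auto elim: quotientE)
  define i where "i = (LEAST i. u i \<noteq> 0)"
  have ex: "\<exists>i. u i \<noteq> 0" using u by (auto simp: nonzero_vecs_def)
  have ui: "u i \<noteq> 0" unfolding i_def using ex by (rule LeastI_ex)
  have uj: "u j = 0" if "j < i" for j using not_less_Least[of j "\<lambda>i. u i \<noteq> 0"] that i_def by auto
  show ?thesis
  proof (rule ex1I)
    let ?w = "\<lambda>j. inverse (u i) * u j"
    have "?w \<in> nonzero_vecs n" using u ui by (auto simp: nonzero_vecs_def)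
    moreover have "inverse (u i) \<noteq> 0" using ui by simp
    ultimately have "?w \<in> P" using u unfolding P proj_rel_def by blast
    moreover have "?w i = 1 \<and> (\<forall>j<i. ?w j = 0)" using ui uj by simp
    ultimately show "?w \<in> P \<and> (\<exists>k. ?w k = 1 \<and> (\<forall>j<k. ?w j = 0))" by blast
  next
    fix v assume v: "v \<in> P \<and> (\<exists>i. v i = 1 \<and> (\<forall>j<i. v j = 0))"
    then obtain k where k: "v k = 1" "\<forall>j<k. v j = 0" by blast
    obtain c where c: "c \<noteq> 0" "\<And>i. v i = c * u i" using v by (auto simp: P proj_rel_def)
    have "k = i"
    proof (rule linorder_cases[of k i])
      assume "k < i" then show ?thesis using uj[of k] c(2)[of k] k by simp
    next
      assume "i < k" then show ?thesis using ui c(1) c(2)[of i] k by simp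
    qed
    then have "c = inverse (u i)" using c(2)[of i] k(1) ui by (simp add: field_simps)
    then show "v = (\<lambda>j. inverse (u i) * u j)" using c(2) by auto
  qed
qed

section \<open>Projective nested cartesian sets\<close>

definition proj_cartesian :: "nat \<Rightarrow> (nat \<Rightarrow> 'a::field set) \<Rightarrow> (nat \<Rightarrow> 'a) set set" where
  "proj_cartesian n A = {P \<in> proj_space n. \<exists>a\<in>P. \<forall>i\<le>n. a i \<in> A i}"

definition set_ratio :: "'a::field set \<Rightarrow> 'a set \<Rightarrow> 'a set" where
  "set_ratio A B = {a / b |a b. a \<in> A \<and> b \<in> B - {0}}"

definition nested_cartesian :: "nat \<Rightarrow> (nat \<Rightarrow> 'a::field set) \<Rightarrow> bool" where
  "nested_cartesian n A \<longleftrightarrow>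
     (\<forall>i\<le>n. 0 \<in> A i) \<and>
     (\<forall>i\<in>{1..n}. \<forall>j\<in>{i..n}. set_ratio (A j) (A (i - 1)) \<subseteq> A j)"

section \<open>Codes\<close>

text \<open>Words are indexed by the points of \<open>X\<close> themselves rather than by an enumeration of
  them; they are functions that are \<open>undefined\<close> outside \<open>X\<close>, so the zero word
  is \<open>\<lambda>P\<in>X. 0\<close>.\<close>

definition eval_word :: "(nat \<Rightarrow> 'a::field) set set \<Rightarrow> 'a mpol \<Rightarrow> (nat \<Rightarrow> 'a) set \<Rightarrow> 'a" where
  "eval_word X f = (\<lambda>P\<in>X. eval_mpol f (std_rep P))"

definition proj_code ::
    "nat \<Rightarrow> (nat \<Rightarrow> 'a::field) set set \<Rightarrow> nat \<Rightarrow> ((nat \<Rightarrow> 'a) set \<Rightarrow> 'a) set" where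
  "proj_code n X d = eval_word X ` hom_polys n d"

definition hamming_weight :: "'p set \<Rightarrow> ('p \<Rightarrow> 'a::zero) \<Rightarrow> nat" where
  "hamming_weight X c = card {P \<in> X. c P \<noteq> 0}"

text \<open>\<open>Min\<close> is meaningful only if the code has a nonzero word.\<close>

definition min_distance :: "'p set \<Rightarrow> ('p \<Rightarrow> 'a::zero) set \<Rightarrow> nat" where
  "min_distance X C = Min {hamming_weight X c |c. c \<in> C \<and> c \<noteq> (\<lambda>P\<in>X. 0)}"

end

theory Submission imports Defs begin

text \<open>Multiply a power of \<open>X\<^sub>0\<close> by linear factors \<open>X\<^sub>i - b X\<^sub>0\<close> with \<open>b \<in> B\<^sub>i\<close>, where
  \<open>B\<^sub>i \<subseteq> A\<^sub>i - {0}\<close>.  By nestedness, the points of the code with \<open>X\<^sub>0 \<noteq> 0\<close> have standard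
  representatives \<open>(1, a\<^sub>1, \<dots>, a\<^sub>n)\<close> with \<open>a\<^sub>i \<in> A\<^sub>i\<close>, so the product is nonzero only where
  \<open>a\<^sub>i \<in> A\<^sub>i - B\<^sub>i\<close> for all \<open>i\<close>, and it is nonzero at \<open>(1 : 0 : \<dots> : 0)\<close>.  For small \<open>d\<close> take
  \<open>B\<^sub>i = A\<^sub>i - {0}\<close> for \<open>i \<le> k\<close>, \<open>\<ell>\<close> elements for \<open>i = k + 1\<close> and none beyond; for large \<open>d\<close> take
  \<open>B\<^sub>i = A\<^sub>i - {0}\<close> throughout.\<close>

section \<open>Evaluation of polynomials\<close>

text \<open>Exponents outside the support are \<open>0\<close> and contribute factors
  \<open>1\<close>, so monomials with different supports can be compared over one index set.\<close>

lemma prod_keys_superset: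
  fixes v :: "nat \<Rightarrow> 'a::comm_semiring_1"
  assumes "finite S" "Poly_Mapping.keys m \<subseteq> S"
  shows "(\<Prod>i\<in>Poly_Mapping.keys m. v i ^ Poly_Mapping.lookup m i) =
    (\<Prod>i\<in>S. v i ^ Poly_Mapping.lookup m i)"
  using assms by (intro prod.mono_neutral_left) (auto simp: in_keys_iff)

lemma eval_mpol_superset:
  assumes "finite S" "Poly_Mapping.keys f \<subseteq> S"
  shows "eval_mpol f v = (\<Sum>m\<in>S. Poly_Mapping.lookup f m *
       (\<Prod>i\<in>Poly_Mapping.keys m. v i ^ Poly_Mapping.lookup m i))"
  unfolding eval_mpol_def using assms by (intro sum.mono_neutral_left) (auto simp: in_keys_iff)

lemma eval_mpol_single:
  "eval_mpol (Poly_Mapping.single m c) v =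
    c * (\<Prod>i\<in>Poly_Mapping.keys m. v i ^ Poly_Mapping.lookup m i)"
  by (simp add: eval_mpol_def)

lemma eval_mpol_zero [simp]: "eval_mpol 0 v = 0"
  by (simp add: eval_mpol_def)

lemma eval_mpol_one [simp]: "eval_mpol 1 v = 1"
  by (simp add: eval_mpol_single flip: single_one)

lemma eval_mpol_add: "eval_mpol (f + g) v = eval_mpol f v + eval_mpol g v"
proof -
  let ?S = "Poly_Mapping.keys f \<union> Poly_Mapping.keys g"
  have "Poly_Mapping.keys (f + g) \<subseteq> ?S"
    by (rule Poly_Mapping.keys_add)
  then show ?thesis
    by (simp add: eval_mpol_superset[of ?S] lookup_add distrib_right sum.distrib)
qed

lemma eval_mpol_sum: "eval_mpol (sum f S) v = (\<Sum>x\<in>S. eval_mpol (f x) v)"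
  by (induction S rule: infinite_finite_induct) (simp_all add: eval_mpol_add)

lemma eval_mpol_single_mult:
  "eval_mpol (Poly_Mapping.single m a * Poly_Mapping.single k b) v =
    eval_mpol (Poly_Mapping.single m a) v * eval_mpol (Poly_Mapping.single k b) v"
proof -
  let ?S = "Poly_Mapping.keys m \<union> Poly_Mapping.keys k"
  have "Poly_Mapping.keys (m + k) \<subseteq> ?S"
    by (rule Poly_Mapping.keys_add)
  then have "(\<Prod>i\<in>Poly_Mapping.keys (m + k). v i ^ Poly_Mapping.lookup (m + k) i) =
      (\<Prod>i\<in>Poly_Mapping.keys m. v i ^ Poly_Mapping.lookup m i) *
      (\<Prod>i\<in>Poly_Mapping.keys k. v i ^ Poly_Mapping.lookup k i)"
    by (subst (1 2 3) prod_keys_superset[of ?S]) (simp_all add: lookup_add power_add prod.distrib)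
  then show ?thesis
    by (simp add: mult_single eval_mpol_single mult.assoc mult.left_commute)
qed

lemma poly_mapping_sum_single:
  fixes f :: "'b \<Rightarrow>\<^sub>0 'a::comm_monoid_add"
  shows "(\<Sum>m\<in>Poly_Mapping.keys f. Poly_Mapping.single m (Poly_Mapping.lookup f m)) = f"
  by (rule poly_mapping_eqI) (auto simp: lookup_sum lookup_single when_def in_keys_iff)

text \<open>Expanding both factors into monomials reduces this, by bilinearity, to
  \<open>eval_mpol_single_mult\<close>.\<close>

lemma eval_mpol_mult: "eval_mpol (f * g) v = eval_mpol f v * eval_mpol g v"
proof -
  let ?s = "\<lambda>f m. Poly_Mapping.single m (Poly_Mapping.lookup f m)"
  have "f * g = (\<Sum>m\<in>Poly_Mapping.keys f. \<Sum>k\<in>Poly_Mapping.keys g. ?s f m * ?s g k)"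
    by (subst sum_product[symmetric]) (simp add: poly_mapping_sum_single)
  then have "eval_mpol (f * g) v = (\<Sum>m\<in>Poly_Mapping.keys f. \<Sum>k\<in>Poly_Mapping.keys g.
      eval_mpol (?s f m) v * eval_mpol (?s g k) v)"
    by (simp add: eval_mpol_sum eval_mpol_single_mult)
  also have "\<dots> = eval_mpol (\<Sum>m\<in>Poly_Mapping.keys f. ?s f m) v *
      eval_mpol (\<Sum>k\<in>Poly_Mapping.keys g. ?s g k) v"
    by (simp add: eval_mpol_sum sum_product)
  finally show ?thesis
    by (simp add: poly_mapping_sum_single)
qed

lemma eval_mpol_prod: "eval_mpol (prod f S) v = (\<Prod>x\<in>S. eval_mpol (f x) v)"
  by (induction S rule: infinite_finite_induct) (simp_all add: eval_mpol_mult)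

lemma eval_mpol_power: "eval_mpol (f ^ e) v = eval_mpol f v ^ e"
  by (induction e) (simp_all add: eval_mpol_mult)

section \<open>Products of linear forms\<close>

lemma hom_polys_add:
  "f \<in> hom_polys n d \<Longrightarrow> g \<in> hom_polys n d \<Longrightarrow> f + g \<in> hom_polys n d"
  using Poly_Mapping.keys_add[of f g] unfolding hom_polys_def by blast

lemma hom_polys_one [simp]: "1 \<in> hom_polys n 0"
  by (auto simp: hom_polys_def simp flip: single_one)

lemma hom_polys_mult:
  assumes "f \<in> hom_polys n d" "g \<in> hom_polys n e"
  shows "f * g \<in> hom_polys n (d + e)"
  unfolding hom_polys_def
proof safe
  fix m assume "m \<in> Poly_Mapping.keys (f * g)"
  then obtain a b where m: "m = a + b" "a \<in> Poly_Mapping.keys f" "b \<in> Poly_Mapping.keys g"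
    using keys_mult[of f g] by blast
  show "(\<Sum>i\<le>n. Poly_Mapping.lookup m i) = d + e"
    using assms m by (auto simp: hom_polys_def lookup_add sum.distrib)
  fix i assume "i \<in> Poly_Mapping.keys m"
  then show "i \<le> n"
    using assms m Poly_Mapping.keys_add[of a b] unfolding hom_polys_def by blast
qed

lemma hom_polys_prod:
  "(\<And>x. x \<in> S \<Longrightarrow> f x \<in> hom_polys n (d x)) \<Longrightarrow> prod f S \<in> hom_polys n (sum d S)"
  by (induction S rule: infinite_finite_induct) (simp_all add: hom_polys_mult)

lemma hom_polys_power: "f \<in> hom_polys n d \<Longrightarrow> f ^ e \<in> hom_polys n (e * d)"
  by (induction e) (simp_all add: hom_polys_mult)

lemma hom_polys_var:
  "i \<le> n \<Longrightarrow> Poly_Mapping.single (Poly_Mapping.single i 1) c \<in> hom_polys n 1"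
  by (auto simp: hom_polys_def lookup_single when_def)

text \<open>The homogenization of the affine factor \<open>X_i - b\<close>;
  \<open>lin_form 0 0\<close> is the variable \<open>X_0\<close> itself.\<close>

definition lin_form :: "nat \<Rightarrow> 'a::comm_ring_1 \<Rightarrow> 'a mpol" where
  "lin_form i b = Poly_Mapping.single (Poly_Mapping.single i 1) 1 +
     Poly_Mapping.single (Poly_Mapping.single 0 1) (- b)"

lemma eval_lin_form [simp]: "eval_mpol (lin_form i b) v = v i - b * v 0"
  by (simp add: lin_form_def eval_mpol_add eval_mpol_single)

lemma hom_polys_lin_form: "i \<le> n \<Longrightarrow> lin_form i b \<in> hom_polys n 1"
  unfolding lin_form_def by (intro hom_polys_add hom_polys_var) auto

text \<open>Each linear form adds 1 to the degree, and the power of \<open>X_0\<close> fills it up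
  to the desired value. Over a finite type every \<open>B i\<close> is finite, so
  \<open>card (B i)\<close> really counts factors.\<close>

lemma ex_hom_poly_prod_linear:
  fixes B :: "nat \<Rightarrow> 'a::{comm_ring_1, finite} set"
  shows "\<exists>f \<in> hom_polys n (e + (\<Sum>i=1..n. card (B i))).
    \<forall>v. eval_mpol f v = v 0 ^ e * (\<Prod>i=1..n. \<Prod>b\<in>B i. v i - b * v 0)"
proof
  let ?g = "\<lambda>i. \<Prod>b\<in>B i. lin_form i b"
  let ?f = "lin_form 0 0 ^ e * (\<Prod>i=1..n. ?g i) :: 'a mpol"
  show "\<forall>v. eval_mpol ?f v = v 0 ^ e * (\<Prod>i=1..n. \<Prod>b\<in>B i. v i - b * v 0)"
    by (simp add: eval_mpol_mult eval_mpol_power eval_mpol_prod)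
  have "?g i \<in> hom_polys n (\<Sum>b\<in>B i. 1)" if "i \<in> {1..n}" for i
    using that by (intro hom_polys_prod hom_polys_lin_form) auto
  then have "(\<Prod>i=1..n. ?g i) \<in> hom_polys n (\<Sum>i=1..n. card (B i))"
    by (intro hom_polys_prod) simp
  moreover have "(lin_form 0 0 :: 'a mpol) ^ e \<in> hom_polys n (e * 1)"
    by (intro hom_polys_power hom_polys_lin_form) simp
  ultimately show "?f \<in> hom_polys n (e + (\<Sum>i=1..n. card (B i)))"
    by (simp add: hom_polys_mult)
qed

section \<open>Points and their standard representatives\<close>

lemma std_rep_in:
  assumes "P \<in> proj_space n"
  shows "std_rep P \<in> P" "\<exists>i. std_rep P i = 1 \<and> (\<forall>j<i. std_rep P j = 0)"
  using theI'[OF std_rep_unique[OF assms]] unfolding std_rep_def by blast+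

lemma std_rep_eqI:
  assumes "P \<in> proj_space n" "v \<in> P" "v i = 1" "\<forall>j<i. v j = 0"
  shows "std_rep P = v"
  using the1_equality[OF std_rep_unique[OF assms(1)], of v] assms unfolding std_rep_def by blast

lemma proj_space_rel:
  assumes "P \<in> proj_space n" "v \<in> P" "w \<in> P"
  shows "(v, w) \<in> proj_rel n"
  using assms quotient_eq_iff[OF equiv_proj_rel, of P n P v w] by (simp add: proj_space_def)

text \<open>A representative lies in its own class, and distinct classes are disjoint.\<close>

lemma inj_on_std_rep: "inj_on (std_rep :: (nat \<Rightarrow> 'a::field) set \<Rightarrow> _) (proj_space n)"
proof (rule inj_onI)
  fix P Q :: "(nat \<Rightarrow> 'a) set"
  assume *: "P \<in> proj_space n" "Q \<in> proj_space n" "std_rep P = std_rep Q"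
  then have "P \<inter> Q \<noteq> {}"
    using std_rep_in(1)[of P n] std_rep_in(1)[of Q n] by auto
  then show "P = Q"
    using * quotient_disj[OF equiv_proj_rel, of P n Q] unfolding proj_space_def by blast
qed

lemma std_rep_beyond:
  assumes "P \<in> proj_space n" "i > n"
  shows "std_rep P i = 0"
  using proj_space_rel[OF assms(1) std_rep_in(1) std_rep_in(1), OF assms(1) assms(1)] assms(2)
  by (auto simp: proj_rel_def nonzero_vecs_def)

lemma std_rep_0_eq_1:
  assumes "P \<in> proj_space n" "std_rep P 0 \<noteq> 0"
  shows "std_rep P 0 = 1"
  using std_rep_in(2)[OF assms(1)] assms(2) by (metis not_gr_zero)

text \<open>The quotients \<open>A\<^sub>i / A\<^sub>0\<close> in the nestedness condition are exactly the
  normalised coordinates.\<close>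

lemma std_rep_affine:
  assumes "nested_cartesian n A" "P \<in> proj_cartesian n A" "std_rep P 0 \<noteq> 0" "i \<in> {1..n}"
  shows "std_rep P i \<in> A i"
proof -
  from assms(2) obtain a where P: "P \<in> proj_space n" and a: "a \<in> P" "\<forall>i\<le>n. a i \<in> A i"
    by (auto simp: proj_cartesian_def)
  obtain c where c: "c \<noteq> 0" "\<And>j. a j = c * std_rep P j"
    using proj_space_rel[OF P std_rep_in(1)[OF P] a(1)] by (auto simp: proj_rel_def)
  \<comment> \<open>As \<open>std_rep P 0 = 1\<close>, the scaling factor can be read off at
    coordinate 0.\<close>
  have "a 0 = c"
    using c(2)[of 0] std_rep_0_eq_1[OF P assms(3)] by simp
  then have "std_rep P i = a i / a 0"
    using c by simp
  moreover have "a i / a 0 \<in> set_ratio (A i) (A 0)"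
  proof -
    have "a i \<in> A i" "a 0 \<in> A 0 - {0}"
      using a(2) assms(4) c(1) \<open>a 0 = c\<close> by auto
    then show ?thesis
      unfolding set_ratio_def by blast
  qed
  moreover have "set_ratio (A i) (A 0) \<subseteq> A i"
  proof -
    \<comment> \<open>Nestedness is used at its first index 1, whose predecessor gives the
      denominators \<open>A 0\<close>.\<close>
    have "1 \<in> {1..n}" "i \<in> {1..n}"
      using assms(4) by auto
    then have "set_ratio (A i) (A (1 - 1)) \<subseteq> A i"
      using assms(1) unfolding nested_cartesian_def by blast
    then show ?thesis
      by simp
  qed
  ultimately show ?thesis
    by auto
qed

text \<open>Supplies the point at which the constructed polynomials stay nonzero.\<close>

lemma ex_origin:
  fixes A :: "nat \<Rightarrow> 'a::field set"
  assumes "nested_cartesian n A" "card (A 0) \<ge> 2"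
  shows "\<exists>P \<in> proj_cartesian n A. std_rep P = (\<lambda>i. if i = 0 then 1 else 0)"
proof -
  define u where "u = (\<lambda>i::nat. if i = 0 then 1 else 0 :: 'a)"
  have u_simps: "u 0 = 1" "i > 0 \<Longrightarrow> u i = 0" for i
    by (simp_all add: u_def)
  have "\<not> A 0 \<subseteq> {0}"
    using assms(2) card_mono[of "{0}" "A 0"] by force
  then obtain c where c: "c \<in> A 0" "c \<noteq> 0"
    by blast
  \<comment> \<open>\<open>1\<close> need not lie in \<open>A 0\<close>, so membership in the
    cartesian set is witnessed by the multiple \<open>w\<close> of \<open>u\<close>, with
    \<open>w 0 = c\<close>.\<close>
  define w where "w = (\<lambda>i. c * u i)"
  define P where "P = proj_rel n `` {u}"
  have u: "u \<in> nonzero_vecs n"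
    unfolding nonzero_vecs_def by (rule CollectI, rule conjI) (use u_simps in force)+
  have w: "w \<in> nonzero_vecs n"
    using u c(2) by (simp add: nonzero_vecs_def w_def)
  have P: "P \<in> proj_space n"
    unfolding P_def proj_space_def using u by (rule quotientI)
  have "u \<in> P"
    unfolding P_def by (rule equiv_class_self[OF equiv_proj_rel u])
  then have "std_rep P = u"
    by (rule std_rep_eqI[OF P, of _ 0]) (simp_all add: u_simps)
  moreover have "\<exists>c. c \<noteq> 0 \<and> (\<forall>i. w i = c * u i)"
    using c(2) by (auto simp: w_def)
  then have "w \<in> P"
    using u w by (simp add: P_def proj_rel_def)
  moreover have "\<forall>i\<le>n. w i \<in> A i"
    using c(1) assms(1) by (simp add: nested_cartesian_def w_def u_def)
  ultimately show ?thesis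
    using P unfolding proj_cartesian_def u_def by blast
qed

lemma finite_proj_space: "finite (proj_space n :: (nat \<Rightarrow> 'a::{field, finite}) set set)"
proof (rule inj_on_finite[OF inj_on_std_rep])
  show "std_rep ` proj_space n \<subseteq> {v :: nat \<Rightarrow> 'a. \<forall>i. (i \<in> {..n} \<longrightarrow> v i \<in> UNIV) \<and>
      (i \<notin> {..n} \<longrightarrow> v i = 0)}"
    by (auto simp: std_rep_beyond)
  show "finite {v :: nat \<Rightarrow> 'a. \<forall>i. (i \<in> {..n} \<longrightarrow> v i \<in> UNIV) \<and>
      (i \<notin> {..n} \<longrightarrow> v i = 0)}"
    by (rule finite_set_of_finite_funs) auto
qed

section \<open>Minimum distance\<close>

lemma min_distance_le:
  assumes "finite X" "c \<in> C" "P \<in> X" "c P \<noteq> 0"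
  shows "min_distance X C \<le> hamming_weight X c"
  unfolding min_distance_def
proof (rule Min_le)
  \<comment> \<open>Weights are at most \<open>card X\<close>, so \<open>Min\<close> is taken over a
    finite set.\<close>
  have "{hamming_weight X c |c. c \<in> C \<and> c \<noteq> (\<lambda>P\<in>X. 0)} \<subseteq> {..card X}"
    using assms(1) by (auto simp: hamming_weight_def intro!: card_mono)
  then show "finite {hamming_weight X c |c. c \<in> C \<and> c \<noteq> (\<lambda>P\<in>X. 0)}"
    by (rule finite_subset) simp
  have "c \<noteq> (\<lambda>P\<in>X. 0)"
    using assms(3,4) by auto
  then show "hamming_weight X c \<in> {hamming_weight X c |c. c \<in> C \<and> c \<noteq> (\<lambda>P\<in>X. 0)}"
    using assms(2) by blast
qed

text \<open>The minimum is attained at a nonzero word; since words are extensional, such a word has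
  a nonzero entry inside \<open>X\<close>.\<close>

lemma min_distance_pos:
  assumes "finite X" "c \<in> C" "P \<in> X" "c P \<noteq> 0" "C \<subseteq> extensional X"
  shows "min_distance X C > 0"
proof -
  let ?W = "{hamming_weight X c |c. c \<in> C \<and> c \<noteq> (\<lambda>P\<in>X. 0)}"
  have "?W \<subseteq> {..card X}"
    using assms(1) by (auto simp: hamming_weight_def intro!: card_mono)
  then have "finite ?W"
    by (rule finite_subset) simp
  moreover have "c \<noteq> (\<lambda>P\<in>X. 0)"
    using assms(3,4) by auto
  then have "?W \<noteq> {}"
    using assms(2) by blast
  ultimately have "min_distance X C \<in> ?W"
    unfolding min_distance_def by (rule Min_in)
  then obtain c' where c': "min_distance X C = hamming_weight X c'" "c' \<in> C" "c' \<noteq> (\<lambda>P\<in>X. 0)"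
    by blast
  have "{P \<in> X. c' P \<noteq> 0} \<noteq> {}"
  proof
    assume "{P \<in> X. c' P \<noteq> 0} = {}"
    then have "c' = (\<lambda>P\<in>X. 0)"
      using c'(2) assms(5) by (intro extensionalityI[of _ X]) auto
    with c'(3) show False ..
  qed
  then show ?thesis
    using assms(1) c'(1) by (simp add: hamming_weight_def card_gt_0_iff)
qed

text \<open>The set \<open>B i\<close> consists of the values of the \<open>i\<close>-th coordinate at which the
  polynomial is made to vanish.  As \<open>0 \<notin> B i\<close>, it does not vanish at \<open>(1:0:\<dots>:0)\<close>.\<close>

lemma min_distance_bounds:
  fixes A B :: "nat \<Rightarrow> 'a::{field, finite} set"
  assumes nested: "nested_cartesian n A" and A0: "card (A 0) \<ge> 2"
    and B: "\<And>i. i \<in> {1..n} \<Longrightarrow> 0 \<notin> B i" and "e > 0"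
    and d: "d = e + (\<Sum>i=1..n. card (B i))"
  defines "X \<equiv> proj_cartesian n A"
  shows "min_distance X (proj_code n X d) \<le> (\<Prod>i=1..n. card (A i - B i))"
    and "min_distance X (proj_code n X d) > 0"
proof -
  have XP: "X \<subseteq> proj_space n"
    by (auto simp: X_def proj_cartesian_def)
  then have fin: "finite X"
    using finite_proj_space finite_subset by blast
  obtain f where f: "f \<in> hom_polys n d"
      "\<And>v. eval_mpol f v = v 0 ^ e * (\<Prod>i=1..n. \<Prod>b\<in>B i. v i - b * v 0)"
    using ex_hom_poly_prod_linear[of n e B] d by auto
  let ?c = "eval_word X f"
  have c: "?c \<in> proj_code n X d"
    using f(1) by (auto simp: proj_code_def)
  obtain Q where Q: "Q \<in> X" "std_rep Q = (\<lambda>i. if i = 0 then 1 else 0)"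
    using ex_origin[OF nested A0] unfolding X_def by blast
  have cQ: "?c Q \<noteq> 0"
    using Q B by (auto simp: eval_word_def f(2))
  show "min_distance X (proj_code n X d) > 0"
    by (rule min_distance_pos[OF fin c Q(1) cQ]) (auto simp: proj_code_def eval_word_def)
  \<comment> \<open>The weight is \<open>card ?S\<close>. The affine coordinates \<open>?r\<close>
    will embed the support \<open>?S\<close> into the box with sides
    \<open>A i - B i\<close>.\<close>
  let ?S = "{P \<in> X. ?c P \<noteq> 0}"
  let ?r = "\<lambda>P. restrict (std_rep P) {1..n}"
  have S: "std_rep P 0 = 1 \<and> (\<forall>i\<in>{1..n}. std_rep P i \<in> A i - B i)" if "P \<in> ?S" for P
  proof -
    have P: "P \<in> proj_space n" "P \<in> proj_cartesian n A"
      using that XP by (auto simp: X_def)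
    \<comment> \<open>As \<open>e > 0\<close>, a nonzero value forces \<open>X_0\<close> and every
      linear factor to be nonzero.\<close>
    have nz: "std_rep P 0 \<noteq> 0" "\<And>i b. i \<in> {1..n} \<Longrightarrow> b \<in> B i \<Longrightarrow> std_rep P i \<noteq> b * std_rep P 0"
      using that \<open>e > 0\<close> by (auto simp: eval_word_def f(2))
    then show ?thesis
      using std_rep_0_eq_1[OF P(1) nz(1)] std_rep_affine[OF nested P(2) nz(1)] by force
  qed
  have "inj_on ?r ?S"
  proof (rule inj_onI)
    fix P Q assume PQ: "P \<in> ?S" "Q \<in> ?S" "?r P = ?r Q"
    \<comment> \<open>The coordinates forgotten by \<open>?r\<close> are fixed: coordinate 0 is 1 on
      \<open>?S\<close>, and those beyond \<open>n\<close> are 0.\<close>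
    have "std_rep P i = std_rep Q i" for i
    proof -
      consider "i = 0" | "i \<in> {1..n}" | "i > n"
        by fastforce
      then show ?thesis
      proof cases
        case 1
        then show ?thesis
          using S[OF PQ(1)] S[OF PQ(2)] by simp
      next
        case 2
        then show ?thesis
          using fun_cong[OF PQ(3), of i] by simp
      next
        case 3
        then show ?thesis
          using PQ XP std_rep_beyond[of _ n i] by (metis (no_types, lifting) mem_Collect_eq subsetD)
      qed
    qed
    then show "P = Q"
      using inj_onD[OF inj_on_std_rep, of P Q n] PQ XP by blast
  qed
  moreover have "?r ` ?S \<subseteq> Pi\<^sub>E {1..n} (\<lambda>i. A i - B i)"
    using S by (auto simp: PiE_iff)
  ultimately have "card ?S \<le> card (Pi\<^sub>E {1..n} (\<lambda>i. A i - B i))"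
    by (rule card_inj_on_le) (simp add: finite_PiE)
  then have "hamming_weight X ?c \<le> (\<Prod>i=1..n. card (A i - B i))"
    by (simp add: hamming_weight_def card_PiE)
  with min_distance_le[OF fin c Q(1) cQ]
  show "min_distance X (proj_code n X d) \<le> (\<Prod>i=1..n. card (A i - B i))"
    by linarith
qed

text \<open>Consecutive partial sums cut the range of \<open>m\<close> into half-open intervals;
  \<open>k\<close> selects the interval and \<open>l\<close> is the offset in it.\<close>

lemma ex1_partial_sum_decomposition:
  fixes c :: "nat \<Rightarrow> nat"
  assumes "m < (\<Sum>i=1..n. c i)"
  shows "\<exists>!(k, l). k < n \<and> l < c (k + 1) \<and> m = (\<Sum>i=1..k. c i) + l"
proof -
  have "\<exists>k l. k < n \<and> l < c (k + 1) \<and> m = (\<Sum>i=1..k. c i) + l"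
    using assms
  proof (induction n)
    case (Suc n)
    show ?case
    proof (cases "m < (\<Sum>i=1..n. c i)")
      case True
      with Suc.IH show ?thesis
        using less_SucI by blast
    next
      case False
      with Suc.prems show ?thesis
        by (intro exI[of _ n] exI[of _ "m - (\<Sum>i=1..n. c i)"]) auto
    qed
  qed simp
  \<comment> \<open>For \<open>k < k'\<close> the value lies strictly below the partial sum up to
    \<open>k + 1\<close>, hence below the one up to \<open>k'\<close>.\<close>
  moreover have False
    if "k < k'" "l < c (k + 1)" "(\<Sum>i=1..k. c i) + l = (\<Sum>i=1..k'. c i) + l'" for k k' l l'
  proof -
    have "(\<Sum>i=1..k+1. c i) \<le> (\<Sum>i=1..k'. c i)"
      using that(1) by (intro sum_mono2) auto
    then show False
      using that by simp
  qed
  then have "k = k'" if "l < c (k + 1)" "l' < c (k' + 1)"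
    "(\<Sum>i=1..k. c i) + l = (\<Sum>i=1..k'. c i) + l'" for k k' l l'
    using that(1,2) that(3)[symmetric] that(3) by (cases k k' rule: linorder_cases) blast+
  then have "k = k' \<and> l = l'" if "l < c (k + 1)" "l' < c (k' + 1)"
    "m = (\<Sum>i=1..k. c i) + l" "m = (\<Sum>i=1..k'. c i) + l'" for k k' l l'
    using that by (metis add_left_cancel)
  ultimately show ?thesis
    by (intro ex_ex1I) (simp, clarify, presburger)
qed

theorem lemma3p1:
  fixes n d :: nat
    and A :: "nat \<Rightarrow> 'a::{field, finite} set"
    and D :: "nat \<Rightarrow> nat"
    and X :: "(nat \<Rightarrow> 'a) set set"
    and \<delta> :: nat
  assumes "n \<ge> 1"
    and "\<And>i. i \<le> n \<Longrightarrow> D i = card (A i)"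
    and "2 \<le> D 0"
    and "\<And>i. i < n \<Longrightarrow> D i \<le> D (Suc i)"
    and "nested_cartesian n A"
    and "X = proj_cartesian n A"
    and "\<delta> = min_distance X (proj_code n X d)"
  shows "(1 \<le> d \<and> d \<le> (\<Sum>i=1..n. (D i - 1)) \<longrightarrow>
      (\<exists>!(k, l). k \<le> n - 1 \<and> l < D (k + 1) - 1 \<and> d - 1 = (\<Sum>i=1..k. (D i - 1)) + l) \<and>
      (\<forall>k l. k \<le> n - 1 \<and> l < D (k + 1) - 1 \<and> d - 1 = (\<Sum>i=1..k. (D i - 1)) + l \<longrightarrow>
        \<delta> \<le> (D (k + 1) - l) * (\<Prod>i=k+2..n. D i))) \<and>
    (d > (\<Sum>i=1..n. (D i - 1)) \<longrightarrow> \<delta> = 1)"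
proof -
  have A0: "card (A 0) \<ge> 2"
    using assms(2)[of 0] assms(3) by simp
  have zero: "0 \<in> A i" if "i \<le> n" for i
    using assms(5) that by (simp add: nested_cartesian_def)
  have card_nz: "card (A i - {0}) = D i - 1" if "i \<le> n" for i
    using that assms(2) zero by simp
  have card_zero: "card (A i - (A i - {0})) = 1" if "i \<le> n" for i
    using zero[OF that] by (simp add: Diff_Diff_Int)
  note bounds = min_distance_bounds[OF assms(5) A0, folded assms(6)]
  have "\<exists>!(k, l). k \<le> n - 1 \<and> l < D (k + 1) - 1 \<and> d - 1 = (\<Sum>i=1..k. (D i - 1)) + l"
    if "1 \<le> d" "d \<le> (\<Sum>i=1..n. (D i - 1))"
  proof -
    have "k \<le> n - 1 \<longleftrightarrow> k < n" for k
      using assms(1) by linarith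
    moreover have "d - 1 < (\<Sum>i=1..n. (D i - 1))"
      using that by linarith
    ultimately show ?thesis
      using ex1_partial_sum_decomposition[of "d - 1" "\<lambda>i. D i - 1" n] by simp
  qed
  moreover have "\<delta> \<le> (D (k + 1) - l) * (\<Prod>i=k+2..n. D i)"
    if "1 \<le> d" and k: "k \<le> n - 1" and l: "l < D (k + 1) - 1"
      and d: "d - 1 = (\<Sum>i=1..k. (D i - 1)) + l" for k l
  proof -
    have k1: "k + 1 \<le> n"
      using k assms(1) by linarith
    \<comment> \<open>There are \<open>D (k + 1) - 1 > l\<close> nonzero elements to choose from, so
      \<open>L\<close> can avoid 0.\<close>
    obtain L where L: "L \<subseteq> A (k + 1) - {0}" "card L = l"
      using obtain_subset_with_card_n[of l "A (k + 1) - {0}"] l card_nz[OF k1] by auto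
    define B where "B i = (if i \<le> k then A i - {0} else if i = k + 1 then L else {})" for i
    have split: "{1..n} = {1..k} \<union> ({k+1} \<union> {k+2..n})"
      using k1 by auto
    have "(\<Sum>i=1..n. card (B i)) = (\<Sum>i=1..k. card (B i)) + (card (B (k+1)) + (\<Sum>i=k+2..n. card (B i)))"
      unfolding split by (subst sum.union_disjoint; simp)+
    also have "\<dots> = (\<Sum>i=1..k. (D i - 1)) + l"
      using k1 L(2) by (simp add: B_def card_nz)
    \<comment> \<open>The linear factors have total degree \<open>d - 1\<close>; a single factor
      \<open>X_0\<close>, that is \<open>e = 1\<close>, supplies the missing degree.\<close>
    finally have "d = 1 + (\<Sum>i=1..n. card (B i))"
      using d \<open>1 \<le> d\<close> by simp
    then have "\<delta> \<le> (\<Prod>i=1..n. card (A i - B i))"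
      unfolding assms(7) using L(1) by (intro bounds(1)[of B 1]) (auto simp: B_def)
    also have "\<dots> = (\<Prod>i=1..k. card (A i - B i)) *
        (card (A (k+1) - B (k+1)) * (\<Prod>i=k+2..n. card (A i - B i)))"
      unfolding split by (subst prod.union_disjoint; simp)+
    also have "\<dots> = (D (k + 1) - l) * (\<Prod>i=k+2..n. D i)"
    proof -
      \<comment> \<open>For \<open>i \<le> k\<close> only the value 0 survives; coordinate
        \<open>k + 1\<close> loses \<open>l\<close> values and later ones lose none.\<close>
      have "(\<Prod>i=1..k. card (A i - B i)) = 1"
        using k1 card_zero by (intro prod.neutral) (simp add: B_def)
      moreover have "card (A (k+1) - B (k+1)) = D (k + 1) - l"
        using L k1 assms(2) by (simp add: B_def card_Diff_subset subset_Diff_insert)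
      moreover have "(\<Prod>i=k+2..n. card (A i - B i)) = (\<Prod>i=k+2..n. D i)"
        using assms(2) by (intro prod.cong) (auto simp: B_def)
      ultimately show ?thesis
        by simp
    qed
    finally show ?thesis .
  qed
  moreover have "\<delta> = 1" if "d > (\<Sum>i=1..n. (D i - 1))"
  proof -
    have "(\<Sum>i=1..n. card (A i - {0})) = (\<Sum>i=1..n. (D i - 1))"
      using card_nz by (intro sum.cong) auto
    \<comment> \<open>The surplus degree, positive by assumption, becomes the exponent
      \<open>e\<close> of \<open>X_0\<close>.\<close>
    then have d: "d = (d - (\<Sum>i=1..n. (D i - 1))) + (\<Sum>i=1..n. card (A i - {0}))"
      using that by simp
    have "(\<Prod>i=1..n. card (A i - (A i - {0}))) = 1"
      using card_zero by (intro prod.neutral) simp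
    \<comment> \<open>The upper bound is now 1, and positivity of the minimum distance gives
      equality.\<close>
    then show ?thesis
      unfolding assms(7) using that bounds[of "\<lambda>i. A i - {0}", OF _ _ d] by simp
  qed
  ultimately show ?thesis
    by (intro conjI impI allI) (simp_all only:)
qed

end
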